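(* Let $\mathcal{H}$ be a real Hilbert space, let $L>0$, $\mu\in[0,L[$ and $\rho\ge 0$ be such that $\mu+\rho>0$. Let $f\colon\mathcal{H}\to\mathbb{R}$ be a differentiable $\mu$-strongly convex function such that $\nabla f$ is $L$-Lipschitz continuous, and let $h\colon\mathcal{H}\to\left]-\infty,+\infty\right]$ be proper, lower semicontinuous and $\rho$-strongly convex. Set $F=f+h$ and let $x^*$ be the unique minimizer of $F$ over $\mathcal{H}$. Let $\delta\in[-\mu,\rho]$, set $f_\delta=f+\frac{\delta}{2}\|\cdot\|^2$ and $h_{-\delta}=h-\frac{\delta}{2}\|\cdot\|^2$, let $x_0$ and $y_0$ be arbitrary in $\mathcal{H}$, and let $(x_k)_{k\in\mathbb{N}}$ and $(y_k)_{k\in\mathbb{N}}$ be generated by $$(\forall k\in\mathbb{N})\quad \begin{cases} x_{k+1}=\mathrm{prox}_{(L+\delta)^{-1}h_{-\delta}}\big(y_k-\frac{1}{L+\delta}\nabla f_\delta(y_k)\big)\\[2mm] y_{k+1}=x_{k+1}+\dfrac{\sqrt{(\rho-\delta)+(L+\delta)}-\sqrt{(\rho-\delta)+(\mu+\delta)}}{\sqrt{(\rho-\delta)+(L+\delta)}+\sqrt{(\rho-\delta)+(\mu+\delta)}}\,(x_{k+1}-x_k).\end{cases}$$ Then, for every $\delta\in[-\mu,\rho]$, this algorithm coincides with the algorithm $$(\forall k\in\mathbb{N})\quad \begin{cases} x_{k+1}=\mathrm{prox}_{L^{-1}h}\big(y_k-\frac{1}{L}\nabla f(y_k)\big)\\[2mm]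 y_{k+1}=x_{k+1}+\dfrac{\sqrt{L+\rho}-\sqrt{\mu+\rho}}{\sqrt{L+\rho}+\sqrt{\mu+\rho}}\,(x_{k+1}-x_k),\end{cases}$$ that is, both recursions generate the same sequences from the same starting points $x_0,y_0$. In particular, for every $k\in\mathbb{N}$, $$\Phi_{\mu,\rho}(x_k,z_k)\le\left(1-\sqrt{\frac{\mu+\rho}{L+\rho}}\right)^{k}\Phi_{\mu,\rho}(x_0,z_0),$$ where $$z_k=x_k+\frac{\sqrt{L+\rho}+\sqrt{\mu+\rho}}{\sqrt{\mu+\rho}}\,(y_k-x_k)\quad\text{and}\quad \Phi_{\mu,\rho}(x,z)=F(x)-F(x^* )+\frac{\mu+\rho}{2}\|z-x^*\|^2.$$
   Context: Conventions: for $\sigma\ge 0$, a function $\varphi\colon\mathcal{H}\to\left]-\infty,+\infty\right]$ is $\sigma$-strongly convex if $\varphi-\frac{\sigma}{2}\|\cdot\|^2$ is convex (so $0$-strongly convex means convex). For a proper lower semicontinuous convex function $\varphi$, the proximity operator is $\mathrm{prox}_{\varphi}(x)=\arg\min_{y\in\mathcal{H}}\varphi(y)+\frac12\|y-x\|^2$. $\mathbb{N}$ contains $0$, and $F$ may take the value $+\infty$. *)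

theory Defs
  imports "HOL-Analysis.Analysis"
begin

text \<open>
  Extended-valued functions are maps into \<^typ>\<open>ereal\<close>. The definitions below are meant for functions that
  never take the value \<open>-\<infinity>\<close>; since scaling by a positive real and subtracting a real keep the value
  \<open>\<infinity>\<close>, arithmetic in \<^typ>\<open>ereal\<close> then agrees with the usual conventions.
\<close>

definition proper :: "('a \<Rightarrow> ereal) \<Rightarrow> bool" where
  "proper \<phi> \<longleftrightarrow> (\<forall>x. \<phi> x \<noteq> -\<infinity>) \<and> (\<exists>x. \<phi> x \<noteq> \<infinity>)"

definition lower_semicontinuous :: "('a::topological_space \<Rightarrow> ereal) \<Rightarrow> bool" where
  "lower_semicontinuous \<phi> \<longleftrightarrow> (\<forall>x. \<phi> x \<le> Liminf (at x) \<phi>)"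

definition ext_convex :: "('a::real_vector \<Rightarrow> ereal) \<Rightarrow> bool" where
  "ext_convex \<phi> \<longleftrightarrow>
     (\<forall>x y t. 0 < t \<and> t < 1 \<longrightarrow>
        \<phi> ((1 - t) *\<^sub>R x + t *\<^sub>R y) \<le> ereal (1 - t) * \<phi> x + ereal t * \<phi> y)"

definition strongly_convex :: "real \<Rightarrow> ('a::real_normed_vector \<Rightarrow> ereal) \<Rightarrow> bool" where
  "strongly_convex \<sigma> \<phi> \<longleftrightarrow> ext_convex (\<lambda>x. \<phi> x - ereal (\<sigma> / 2 * (norm x)\<^sup>2))"

definition gradient :: "('a::real_inner \<Rightarrow> real) \<Rightarrow> 'a \<Rightarrow> 'a" where
  "gradient f x = (THE g. GDERIV f x :> g)"

definition prox :: "('a::real_normed_vector \<Rightarrow> ereal) \<Rightarrow> 'a \<Rightarrow> 'a" where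
  "prox \<phi> x = (ARG_MIN (\<lambda>y. \<phi> y + ereal (1 / 2 * (norm (y - x))\<^sup>2)) y. True)"

definition shift_smooth :: "real \<Rightarrow> ('a::real_normed_vector \<Rightarrow> real) \<Rightarrow> 'a \<Rightarrow> real" where
  "shift_smooth \<delta> f x = f x + \<delta> / 2 * (norm x)\<^sup>2"

definition shift_nonsmooth :: "real \<Rightarrow> ('a::real_normed_vector \<Rightarrow> ereal) \<Rightarrow> 'a \<Rightarrow> ereal" where
  "shift_nonsmooth \<delta> h x = h x - ereal (\<delta> / 2 * (norm x)\<^sup>2)"

text \<open>
  The two recursions, as predicates on pairs of sequences: they hold exactly when the sequences
  \<open>x\<close>, \<open>y\<close> are the ones generated from the starting points \<open>x0\<close>, \<open>y0\<close>.
\<close>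

definition shifted_algorithm ::
  "('a::real_inner \<Rightarrow> real) \<Rightarrow> ('a \<Rightarrow> ereal) \<Rightarrow> real \<Rightarrow> real \<Rightarrow> real \<Rightarrow> real \<Rightarrow> 'a \<Rightarrow> 'a
     \<Rightarrow> (nat \<Rightarrow> 'a) \<Rightarrow> (nat \<Rightarrow> 'a) \<Rightarrow> bool" where
  "shifted_algorithm f h L \<mu> \<rho> \<delta> x0 y0 x y \<longleftrightarrow>
     x 0 = x0 \<and> y 0 = y0 \<and>
     (\<forall>k. x (Suc k) =
            prox (\<lambda>u. ereal (1 / (L + \<delta>)) * shift_nonsmooth \<delta> h u)
              (y k - (1 / (L + \<delta>)) *\<^sub>R gradient (shift_smooth \<delta> f) (y k)) \<and>
          y (Suc k) =
            x (Suc k) +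
              ((sqrt ((\<rho> - \<delta>) + (L + \<delta>)) - sqrt ((\<rho> - \<delta>) + (\<mu> + \<delta>))) /
               (sqrt ((\<rho> - \<delta>) + (L + \<delta>)) + sqrt ((\<rho> - \<delta>) + (\<mu> + \<delta>)))) *\<^sub>R
              (x (Suc k) - x k))"

definition unshifted_algorithm ::
  "('a::real_inner \<Rightarrow> real) \<Rightarrow> ('a \<Rightarrow> ereal) \<Rightarrow> real \<Rightarrow> real \<Rightarrow> real \<Rightarrow> 'a \<Rightarrow> 'a
     \<Rightarrow> (nat \<Rightarrow> 'a) \<Rightarrow> (nat \<Rightarrow> 'a) \<Rightarrow> bool" where
  "unshifted_algorithm f h L \<mu> \<rho> x0 y0 x y \<longleftrightarrow>
     x 0 = x0 \<and> y 0 = y0 \<and>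
     (\<forall>k. x (Suc k) =
            prox (\<lambda>u. ereal (1 / L) * h u) (y k - (1 / L) *\<^sub>R gradient f (y k)) \<and>
          y (Suc k) =
            x (Suc k) +
              ((sqrt (L + \<rho>) - sqrt (\<mu> + \<rho>)) / (sqrt (L + \<rho>) + sqrt (\<mu> + \<rho>))) *\<^sub>R
              (x (Suc k) - x k))"

definition z_seq :: "real \<Rightarrow> real \<Rightarrow> real \<Rightarrow> (nat \<Rightarrow> 'a) \<Rightarrow> (nat \<Rightarrow> 'a) \<Rightarrow> nat \<Rightarrow> 'a::real_vector" where
  "z_seq L \<mu> \<rho> x y k =
     x k + ((sqrt (L + \<rho>) + sqrt (\<mu> + \<rho>)) / sqrt (\<mu> + \<rho>)) *\<^sub>R (y k - x k)"

definition Phi :: "('a::real_normed_vector \<Rightarrow> ereal) \<Rightarrow> 'a \<Rightarrow> real \<Rightarrow> real \<Rightarrow> 'a \<Rightarrow> 'a \<Rightarrow> ereal" where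
  "Phi F xstar \<mu> \<rho> x z = F x - F xstar + ereal ((\<mu> + \<rho>) / 2 * (norm (z - xstar))\<^sup>2)"

lemma ext_convex_ereal_iff: "ext_convex (\<lambda>x. ereal (g x)) \<longleftrightarrow> convex_on UNIV g"
proof
  assume "ext_convex (\<lambda>x. ereal (g x))"
  then show "convex_on UNIV g"
    by (intro convex_onI) (auto simp: ext_convex_def)
next
  assume "convex_on UNIV g"
  then show "ext_convex (\<lambda>x. ereal (g x))"
    by (simp add: ext_convex_def convex_onD)
qed

lemma strongly_convex_ereal_iff:
  "strongly_convex \<sigma> (\<lambda>x. ereal (f x)) \<longleftrightarrow> convex_on UNIV (\<lambda>x. f x - \<sigma> / 2 * (norm x)\<^sup>2)"
  by (simp add: strongly_convex_def ext_convex_ereal_iff)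

lemma gradient_eqI:
  assumes "GDERIV f x :> g"
  shows "gradient f x = g"
  unfolding gradient_def
proof (rule the_equality[of _ g])
  fix g' assume "GDERIV f x :> g'"
  with assms have "(\<lambda>v. inner v g') = (\<lambda>v. inner v g)"
    unfolding gderiv_def by (rule has_derivative_unique[rotated])
  then have "inner (g' - g) g' = inner (g' - g) g"
    by metis
  then have "inner (g' - g) (g' - g) = 0"
    by (simp add: inner_diff_right)
  then show "g' = g" by simp
qed (rule assms)

end

theory Submission
  imports Defs
begin

text \<open>
  Completing the square in the objective of the shifted proximal step shows that, up to a positive
  factor and an additive constant, it is the function
  \<open>u \<mapsto> h u + \<langle>\<nabla>f y, u - y\<rangle> + L/2 \<parallel>u - y\<parallel>\<^sup>2\<close>, whatever \<open>\<delta>\<close> is: what the shift adds to the gradient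
  and to the step size compensates what it removes from \<open>h\<close>
  (\<open>prox_shifted_eq_arg_min_fb_model\<close>). The momentum coefficient depends on the parameters only
  through \<open>L + \<rho>\<close> and \<open>\<mu> + \<rho>\<close>, so the two recursions are the same.

  For the rate, put \<open>m = \<mu> + \<rho>\<close>, \<open>\<Lambda> = L + \<rho>\<close> and \<open>\<alpha> = sqrt (m/\<Lambda>)\<close>. The function above is
  \<open>\<Lambda>\<close>-strongly convex, hence it grows quadratically away from its minimizer \<open>T\<close>. Together with the
  descent lemma and the strong convexity of \<open>f\<close> this gives, for every \<open>u\<close>,
  \<open>F T + \<Lambda>/2 \<parallel>u - T\<parallel>\<^sup>2 \<le> F u + (\<Lambda> - m)/2 \<parallel>u - y\<parallel>\<^sup>2\<close> (\<open>forward_backward_inequality\<close>).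
  With \<open>T = x\<^sub>k\<^sub>+\<^sub>1\<close>, \<open>y = y\<^sub>k\<close> and \<open>u = (1 - \<alpha>) x\<^sub>k + \<alpha> x\<^sup>*\<close>, strong convexity of \<open>F\<close> at \<open>u\<close> turns
  it into a decrease of the Lyapunov function by the factor \<open>1 - \<alpha>\<close> (\<open>lyapunov_decrease\<close>), because
  \<open>z\<^sub>k\<^sub>+\<^sub>1 = x\<^sub>k + (x\<^sub>k\<^sub>+\<^sub>1 - x\<^sub>k)/\<alpha>\<close>.

  Three existence statements are involved: proximal points, the minimizer of \<open>F\<close>, and the gradient,
  which represents the Frechet derivative by an inner product. All three come from the existence of
  minimizers of proper lower semicontinuous strongly convex functions on a complete space
  (\<open>strongly_convex_minimizer_exists\<close>), the last one through a quadratic minimization problem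
  (\<open>riesz_representation\<close>).
\<close>

section \<open>Strong convexity of extended-valued functions\<close>

text \<open>The defect in the convexity inequality of the squared norm; every strong convexity estimate
  below comes from it.\<close>

lemma norm_convex_combination_squared:
  fixes x y :: "'a::real_inner"
  shows "(norm ((1 - t) *\<^sub>R x + t *\<^sub>R y))\<^sup>2
    = (1 - t) * (norm x)\<^sup>2 + t * (norm y)\<^sup>2 - t * (1 - t) * (norm (x - y))\<^sup>2"
  unfolding power2_norm_eq_inner by (simp add: inner_simps inner_commute algebra_simps)

text \<open>Moves the quadratic from one side of the convexity inequality to the other; \<open>X\<close>, \<open>Y\<close>, \<open>Z\<close> stand
  for the squared norms of \<open>x\<close>, \<open>y\<close> and \<open>x - y\<close>.\<close>

lemma ereal_convexity_defect_iff:
  "e - ereal (\<sigma> / 2 * ((1 - t) * X + t * Y - t * (1 - t) * Z))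
      \<le> ereal (1 - t) * (ereal a - ereal (\<sigma> / 2 * X)) + ereal t * (ereal b - ereal (\<sigma> / 2 * Y))
    \<longleftrightarrow> e \<le> ereal ((1 - t) * a + t * b - \<sigma> / 2 * (t * (1 - t)) * Z)"
proof -
  have "(1 - t) * (a - s * X) + t * (b - s * Y) + s * ((1 - t) * X + t * Y - t * (1 - t) * Z)
      = (1 - t) * a + t * b - s * (t * (1 - t)) * Z" for s :: real
    by (simp add: algebra_simps)
  from this[of "\<sigma> / 2"] show ?thesis
    by (cases e) (simp_all, linarith)
qed

text \<open>Restricting the points to the effective domain turns the inequality into one between reals.
  Outside of it the right-hand side of the convexity inequality is \<open>\<infinity>\<close>.\<close>

lemma strongly_convex_iff:
  fixes \<phi> :: "'a::real_inner \<Rightarrow> ereal"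
  assumes "\<And>x. \<phi> x \<noteq> -\<infinity>"
  shows "strongly_convex \<sigma> \<phi> \<longleftrightarrow>
    (\<forall>x y t a b. 0 < t \<and> t < 1 \<and> \<phi> x = ereal a \<and> \<phi> y = ereal b \<longrightarrow>
      \<phi> ((1 - t) *\<^sub>R x + t *\<^sub>R y)
        \<le> ereal ((1 - t) * a + t * b - \<sigma> / 2 * (t * (1 - t)) * (norm (x - y))\<^sup>2))"
    (is "_ \<longleftrightarrow> (\<forall>x y t a b. ?P x y t a b)")
proof
  assume sc: "strongly_convex \<sigma> \<phi>"
  show "\<forall>x y t a b. ?P x y t a b"
  proof (intro allI impI, elim conjE)
    fix x y :: 'a and t a b :: real
    assume t: "0 < t" "t < 1" and ab: "\<phi> x = ereal a" "\<phi> y = ereal b"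
    have "\<phi> ((1 - t) *\<^sub>R x + t *\<^sub>R y)
        - ereal (\<sigma> / 2 * (norm ((1 - t) *\<^sub>R x + t *\<^sub>R y))\<^sup>2)
      \<le> ereal (1 - t) * (\<phi> x - ereal (\<sigma> / 2 * (norm x)\<^sup>2))
        + ereal t * (\<phi> y - ereal (\<sigma> / 2 * (norm y)\<^sup>2))"
      using sc t unfolding strongly_convex_def ext_convex_def by blast
    then show "\<phi> ((1 - t) *\<^sub>R x + t *\<^sub>R y)
        \<le> ereal ((1 - t) * a + t * b - \<sigma> / 2 * (t * (1 - t)) * (norm (x - y))\<^sup>2)"
      unfolding norm_convex_combination_squared ab ereal_convexity_defect_iff .
  qed
next
  assume *: "\<forall>x y t a b. ?P x y t a b"
  show "strongly_convex \<sigma> \<phi>"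
    unfolding strongly_convex_def ext_convex_def
  proof (intro allI impI, elim conjE)
    fix x y :: 'a and t :: real assume t: "0 < t" "t < 1"
    show "\<phi> ((1 - t) *\<^sub>R x + t *\<^sub>R y)
        - ereal (\<sigma> / 2 * (norm ((1 - t) *\<^sub>R x + t *\<^sub>R y))\<^sup>2)
      \<le> ereal (1 - t) * (\<phi> x - ereal (\<sigma> / 2 * (norm x)\<^sup>2))
        + ereal t * (\<phi> y - ereal (\<sigma> / 2 * (norm y)\<^sup>2))"
    proof (cases "\<phi> x = \<infinity> \<or> \<phi> y = \<infinity>")
      case True
      then have inf: "ereal (1 - t) * (\<phi> x - ereal (\<sigma> / 2 * (norm x)\<^sup>2))
        + ereal t * (\<phi> y - ereal (\<sigma> / 2 * (norm y)\<^sup>2)) = \<infinity>"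
        using t assms[of x] assms[of y] by (cases "\<phi> x"; cases "\<phi> y") auto
      show ?thesis unfolding inf by simp
    next
      case False
      then obtain a b where ab: "\<phi> x = ereal a" "\<phi> y = ereal b"
        using assms[of x] assms[of y] by (cases "\<phi> x"; cases "\<phi> y") auto
      then have "\<phi> ((1 - t) *\<^sub>R x + t *\<^sub>R y)
        \<le> ereal ((1 - t) * a + t * b - \<sigma> / 2 * (t * (1 - t)) * (norm (x - y))\<^sup>2)"
        using * t by blast
      then show ?thesis
        unfolding norm_convex_combination_squared ab ereal_convexity_defect_iff .
    qed
  qed
qed

lemma strongly_convexD:
  fixes \<phi> :: "'a::real_inner \<Rightarrow> ereal"
  assumes "strongly_convex \<sigma> \<phi>" "\<And>x. \<phi> x \<noteq> -\<infinity>" "0 < t" "t < 1"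
    and "\<phi> x = ereal a" "\<phi> y = ereal b"
  shows "\<phi> ((1 - t) *\<^sub>R x + t *\<^sub>R y)
    \<le> ereal ((1 - t) * a + t * b - \<sigma> / 2 * (t * (1 - t)) * (norm (x - y))\<^sup>2)"
  using assms(1,3-) unfolding strongly_convex_iff[of \<phi>, OF assms(2)] by blast

lemma strongly_convex_add_real:
  fixes \<phi> :: "'a::real_inner \<Rightarrow> ereal"
  assumes \<phi>: "\<And>x. \<phi> x \<noteq> -\<infinity>" "strongly_convex \<sigma> \<phi>"
    and g: "strongly_convex \<tau> (\<lambda>x. ereal (g x))"
  shows "strongly_convex (\<sigma> + \<tau>) (\<lambda>x. \<phi> x + ereal (g x))"
proof -
  have fin: "\<phi> x + ereal (g x) \<noteq> -\<infinity>" for x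
    using \<phi>(1)[of x] by (cases "\<phi> x") auto
  show ?thesis
    unfolding strongly_convex_iff[of "\<lambda>x. \<phi> x + ereal (g x)", OF fin]
  proof (intro allI impI, elim conjE)
    fix x y :: 'a and t a b :: real
    assume t: "0 < t" "t < 1"
      and ab: "\<phi> x + ereal (g x) = ereal a" "\<phi> y + ereal (g y) = ereal b"
    have xy: "\<phi> x = ereal (a - g x)" "\<phi> y = ereal (b - g y)"
      using ab by (cases "\<phi> x"; cases "\<phi> y"; auto)+
    have "ereal (g ((1 - t) *\<^sub>R x + t *\<^sub>R y))
      \<le> ereal ((1 - t) * g x + t * g y - \<tau> / 2 * (t * (1 - t)) * (norm (x - y))\<^sup>2)"
      by (rule strongly_convexD[OF g _ t]) auto
    moreover note strongly_convexD[OF \<phi>(2,1) t xy]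
    ultimately show "\<phi> ((1 - t) *\<^sub>R x + t *\<^sub>R y) + ereal (g ((1 - t) *\<^sub>R x + t *\<^sub>R y))
      \<le> ereal ((1 - t) * a + t * b - (\<sigma> + \<tau>) / 2 * (t * (1 - t)) * (norm (x - y))\<^sup>2)"
      by (cases "\<phi> ((1 - t) *\<^sub>R x + t *\<^sub>R y)") (auto simp: field_simps)
  qed
qed

lemma strongly_convex_quadratic:
  fixes \<alpha> :: "'a::real_inner \<Rightarrow> real"
  assumes "linear \<alpha>"
  shows "strongly_convex \<sigma> (\<lambda>u. ereal (\<alpha> (u - c) + \<sigma> / 2 * (norm (u - c))\<^sup>2))"
  unfolding strongly_convex_ereal_iff
proof (rule convex_onI)
  fix t :: real and x y :: 'a
  define \<beta> where "\<beta> u = \<alpha> u - \<sigma> * inner u c" for u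
  define d where "d = \<sigma> / 2 * (norm c)\<^sup>2 - \<alpha> c"
  have eq: "\<alpha> (u - c) + \<sigma> / 2 * (norm (u - c))\<^sup>2 - \<sigma> / 2 * (norm u)\<^sup>2
      = \<beta> u + d" for u
    by (simp add: \<beta>_def d_def power2_norm_eq_inner inner_simps inner_commute linear_diff[OF assms]
        algebra_simps)
  have "\<beta> ((1 - t) *\<^sub>R x + t *\<^sub>R y) = (1 - t) * \<beta> x + t * \<beta> y"
    by (simp add: \<beta>_def linear_add[OF assms] linear_diff[OF assms]
        linear_scale[OF assms] inner_simps algebra_simps)
  then show "\<alpha> ((1 - t) *\<^sub>R x + t *\<^sub>R y - c)
        + \<sigma> / 2 * (norm ((1 - t) *\<^sub>R x + t *\<^sub>R y - c))\<^sup>2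
        - \<sigma> / 2 * (norm ((1 - t) *\<^sub>R x + t *\<^sub>R y))\<^sup>2
      \<le> (1 - t) * (\<alpha> (x - c) + \<sigma> / 2 * (norm (x - c))\<^sup>2 - \<sigma> / 2 * (norm x)\<^sup>2)
        + t * (\<alpha> (y - c) + \<sigma> / 2 * (norm (y - c))\<^sup>2 - \<sigma> / 2 * (norm y)\<^sup>2)"
    unfolding eq by (simp add: algebra_simps)
qed simp

section \<open>Minimizers of strongly convex functions\<close>

lemma lower_semicontinuous_nhds:
  assumes "lower_semicontinuous \<phi>" "c < \<phi> x"
  shows "eventually (\<lambda>y. c < \<phi> y) (nhds x)"
proof -
  have "c < Liminf (at x) \<phi>"
    using assms unfolding lower_semicontinuous_def by (meson less_le_trans)
  from less_LiminfD[OF this] assms(2) show ?thesis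
    unfolding eventually_nhds_conv_at by simp
qed

lemma lower_semicontinuous_add_continuous:
  fixes \<phi> :: "'a::t2_space \<Rightarrow> ereal"
  assumes \<phi>: "lower_semicontinuous \<phi>" "\<And>x. \<phi> x \<noteq> -\<infinity>" and g: "\<And>x. isCont g x"
  shows "lower_semicontinuous (\<lambda>x. \<phi> x + ereal (g x))"
  unfolding lower_semicontinuous_def le_Liminf_iff
proof (intro allI impI)
  fix x and c :: ereal assume "c < \<phi> x + ereal (g x)"
  then have "c - ereal (g x) < \<phi> x"
    by (cases "\<phi> x"; cases c; auto)
  then obtain d where d: "c - ereal (g x) < ereal d" "ereal d < \<phi> x"
    using ereal_dense2 by blast
  show "eventually (\<lambda>y. c < \<phi> y + ereal (g y)) (at x)"
  proof (cases c)
    case (real r)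
    then have "r - d < g x" using d(1) by simp
    then have "eventually (\<lambda>y. r - d < g y) (at x)"
      using g[of x] unfolding isCont_def by (metis order_tendstoD(1))
    moreover have "eventually (\<lambda>y. ereal d < \<phi> y) (at x)"
      using lower_semicontinuous_nhds[OF \<phi>(1) d(2)] by (simp add: eventually_nhds_conv_at)
    ultimately show ?thesis
    proof eventually_elim
      case (elim y)
      then show ?case using real by (cases "\<phi> y") auto
    qed
  next
    case PInf
    with d show ?thesis by simp
  next
    case MInf
    have "c < \<phi> y + ereal (g y)" for y
      using MInf \<phi>(2)[of y] by (cases "\<phi> y") auto
    then show ?thesis by simp
  qed
qed

text \<open>Compare the minimizer \<open>p\<close> with the points of the segment from \<open>p\<close> to \<open>u\<close>, and let them tend
  to \<open>p\<close>.\<close>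

lemma strongly_convex_minimizer_growth:
  fixes \<phi> :: "'a::real_inner \<Rightarrow> ereal"
  assumes sc: "strongly_convex \<sigma> \<phi>" and fin: "\<And>x. \<phi> x \<noteq> -\<infinity>"
    and min: "\<And>u. \<phi> p \<le> \<phi> u"
  shows "\<phi> p + ereal (\<sigma> / 2 * (norm (u - p))\<^sup>2) \<le> \<phi> u"
proof (cases "\<phi> u")
  case (real b)
  then obtain m where m: "\<phi> p = ereal m"
    using min[of u] fin[of p] by (cases "\<phi> p") auto
  have *: "m + \<sigma> / 2 * (1 - t) * (norm (p - u))\<^sup>2 \<le> b" if t: "0 < t" "t < 1" for t
  proof -
    have "ereal m \<le> ereal ((1 - t) * m + t * b - \<sigma> / 2 * (t * (1 - t)) * (norm (p - u))\<^sup>2)"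
      using min strongly_convexD[OF sc fin t m real] m by (metis order_trans)
    then have "t * (m + \<sigma> / 2 * (1 - t) * (norm (p - u))\<^sup>2) \<le> t * b"
      by (simp add: algebra_simps)
    then show ?thesis using t by simp
  qed
  have "((\<lambda>t. m + \<sigma> / 2 * (1 - t) * (norm (p - u))\<^sup>2) \<longlongrightarrow> m + \<sigma> / 2 * (1 - 0) * (norm (p - u))\<^sup>2)
      (at_right 0)"
    by (intro tendsto_intros)
  moreover have "eventually (\<lambda>t. m + \<sigma> / 2 * (1 - t) * (norm (p - u))\<^sup>2 \<le> b) (at_right 0)"
    using * by (auto simp: eventually_at_right_field intro!: exI[of _ 1])
  ultimately have "m + \<sigma> / 2 * (1 - 0) * (norm (p - u))\<^sup>2 \<le> b"
    by (rule tendsto_upperbound) simp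
  then show ?thesis using m real by (simp add: norm_minus_commute)
qed (use fin in auto)

text \<open>Lower semicontinuity bounds the function below on a ball around a point of its domain. A point
  outside of the ball is handled by the convexity inequality on the segment that joins it to the
  centre: the resulting bound is a quadratic in the distance with positive leading coefficient.\<close>

lemma strongly_convex_bounded_below:
  fixes \<phi> :: "'a::real_inner \<Rightarrow> ereal"
  assumes "proper \<phi>" and lsc: "lower_semicontinuous \<phi>"
    and sc: "strongly_convex \<sigma> \<phi>" and \<sigma>: "\<sigma> > 0"
  obtains m where "\<And>u. ereal m \<le> \<phi> u"
proof -
  have fin: "\<phi> x \<noteq> -\<infinity>" for x using \<open>proper \<phi>\<close> by (simp add: proper_def)
  obtain c where "\<phi> c \<noteq> \<infinity>" using \<open>proper \<phi>\<close> by (auto simp: proper_def)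
  then obtain \<alpha> where \<alpha>: "\<phi> c = ereal \<alpha>" using fin[of c] by (cases "\<phi> c") auto
  have "eventually (\<lambda>y. ereal (\<alpha> - 1) < \<phi> y) (nhds c)"
    by (rule lower_semicontinuous_nhds[OF lsc]) (simp add: \<alpha>)
  then obtain r where r: "r > 0" and ball: "\<And>y. dist y c < r \<Longrightarrow> ereal (\<alpha> - 1) < \<phi> y"
    unfolding eventually_nhds_metric by blast
  have "ereal (\<alpha> - 1 - 4 / (\<sigma> * r\<^sup>2)) \<le> \<phi> u" for u
  proof (cases "dist u c < r")
    case True
    have "4 / (\<sigma> * r\<^sup>2) \<ge> 0" using \<sigma> by simp
    then have "ereal (\<alpha> - 1 - 4 / (\<sigma> * r\<^sup>2)) \<le> ereal (\<alpha> - 1)" by simp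
    also have "\<dots> \<le> \<phi> u" using ball[OF True] by simp
    finally show ?thesis .
  next
    case False
    show ?thesis
    proof (cases "\<phi> u")
      case (real b)
      define D where "D = norm (c - u)"
      have D: "D \<ge> r" using False by (simp add: D_def dist_norm norm_minus_commute)
      \<comment> \<open>The point of the segment at distance \<open>r/2\<close> from the centre, hence inside of the ball.\<close>
      define t where "t = r / (2 * D)"
      have t: "0 < t" "t < 1" "t \<le> 1 / 2" and tD: "t * D = r / 2"
        using r D by (auto simp: t_def field_simps)
      have "dist ((1 - t) *\<^sub>R c + t *\<^sub>R u) c = norm (t *\<^sub>R (u - c))"
        by (simp add: dist_norm algebra_simps)
      also have "\<dots> = t * D" using t by (simp add: D_def norm_minus_commute)
      finally have "ereal (\<alpha> - 1) < \<phi> ((1 - t) *\<^sub>R c + t *\<^sub>R u)"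
        using r tD by (intro ball) simp
      also have "\<dots> \<le> ereal ((1 - t) * \<alpha> + t * b - \<sigma> / 2 * (t * (1 - t)) * D\<^sup>2)"
        unfolding D_def by (rule strongly_convexD[OF sc fin t(1,2) \<alpha> real])
      finally have "t * (\<alpha> - 1 / t + \<sigma> / 2 * (1 - t) * D\<^sup>2) < t * b"
        using t by (simp add: algebra_simps)
      then have 1: "\<alpha> - 1 / t + \<sigma> / 2 * (1 - t) * D\<^sup>2 < b" using t by simp
      have 2: "\<sigma> / 4 * D\<^sup>2 \<le> \<sigma> / 2 * (1 - t) * D\<^sup>2"
        using t \<sigma> by (intro mult_right_mono) auto
      \<comment> \<open>Complete the square in \<open>D\<close>, using \<open>1 / t = 2 * D / r\<close>.\<close>
      have "0 \<le> \<sigma> * (D / 2 - 2 / (r * \<sigma>))\<^sup>2" using \<sigma> by simp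
      also have "\<dots> = \<sigma> / 4 * D\<^sup>2 - 1 / t + 4 / (\<sigma> * r\<^sup>2)"
        using \<sigma> r D by (simp add: t_def power2_eq_square field_simps)
      finally show ?thesis using 1 2 real by simp
    qed (use fin in auto)
  qed
  then show thesis by (rule that)
qed

text \<open>Strong convexity makes every minimizing sequence a Cauchy sequence, and lower semicontinuity
  makes its limit a minimizer.\<close>

lemma strongly_convex_minimizer_exists:
  fixes \<phi> :: "'a::{real_inner, complete_space} \<Rightarrow> ereal"
  assumes pr: "proper \<phi>" and lsc: "lower_semicontinuous \<phi>"
    and sc: "strongly_convex \<sigma> \<phi>" and \<sigma>: "\<sigma> > 0"
  obtains p where "\<And>u. \<phi> p \<le> \<phi> u"
proof -
  have fin: "\<phi> x \<noteq> -\<infinity>" for x using pr by (simp add: proper_def)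
  obtain c where c: "\<phi> c \<noteq> \<infinity>" using pr by (auto simp: proper_def)
  obtain l where l: "\<And>u. ereal l \<le> \<phi> u"
    using strongly_convex_bounded_below[OF pr lsc sc \<sigma>] by blast
  have "ereal l \<le> (INF u. \<phi> u)" using l by (simp add: le_INF_iff)
  moreover have "(INF u. \<phi> u) \<le> \<phi> c" by (simp add: INF_lower)
  ultimately obtain M where M: "(INF u. \<phi> u) = ereal M"
    using c by (cases "INF u. \<phi> u") auto
  have low: "ereal M \<le> \<phi> u" for u by (simp add: M[symmetric] INF_lower)
  have "\<exists>u. \<phi> u < ereal (M + 1 / Suc n)" for n
  proof -
    have "(INF u. \<phi> u) < ereal (M + 1 / Suc n)" by (simp add: M)
    then show ?thesis by (auto simp: INF_less_iff)
  qed
  then obtain X where X: "\<And>n. \<phi> (X n) < ereal (M + 1 / Suc n)" by metis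
  have small: "\<sigma> / 8 * (norm (X i - X j))\<^sup>2 < 1 / Suc n" if ij: "i \<ge> n" "j \<ge> n" for i j n
  proof -
    obtain a b where ab: "\<phi> (X i) = ereal a" "\<phi> (X j) = ereal b"
      using X[of i] X[of j] fin[of "X i"] fin[of "X j"]
      by (cases "\<phi> (X i)"; cases "\<phi> (X j)") auto
    have "ereal M \<le> ereal ((1 - 1 / 2) * a + 1 / 2 * b
        - \<sigma> / 2 * (1 / 2 * (1 - 1 / 2)) * (norm (X i - X j))\<^sup>2)"
      by (rule order_trans[OF low strongly_convexD[OF sc fin _ _ ab]]) auto
    then have "M \<le> a / 2 + b / 2 - \<sigma> / 8 * (norm (X i - X j))\<^sup>2" by simp
    moreover have "a < M + 1 / Suc n"
    proof -
      have "a < M + 1 / Suc i" using X[of i] ab by simp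
      also have "\<dots> \<le> M + 1 / Suc n" using ij by (simp add: frac_le)
      finally show ?thesis .
    qed
    moreover have "b < M + 1 / Suc n"
    proof -
      have "b < M + 1 / Suc j" using X[of j] ab by simp
      also have "\<dots> \<le> M + 1 / Suc n" using ij by (simp add: frac_le)
      finally show ?thesis .
    qed
    ultimately show ?thesis by linarith
  qed
  have "Cauchy X"
  proof (rule CauchyI)
    fix e :: real assume e: "e > 0"
    then have "0 < \<sigma> / 8 * e\<^sup>2" using \<sigma> by simp
    then obtain n where n: "1 / Suc n < \<sigma> / 8 * e\<^sup>2"
      using reals_Archimedean by (metis inverse_eq_divide)
    have "norm (X i - X j) < e" if "i \<ge> n" "j \<ge> n" for i j
    proof -
      have "\<sigma> / 8 * (norm (X i - X j))\<^sup>2 < \<sigma> / 8 * e\<^sup>2"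
        using small[OF that] n by linarith
      then have "(norm (X i - X j))\<^sup>2 < e\<^sup>2" using \<sigma> by simp
      then show ?thesis using e by (simp add: power2_less_imp_less)
    qed
    then show "\<exists>n. \<forall>i\<ge>n. \<forall>j\<ge>n. norm (X i - X j) < e" by blast
  qed
  then obtain p where p: "X \<longlonglongrightarrow> p"
    using Cauchy_convergent convergent_def by blast
  have "\<phi> p \<le> ereal M"
  proof (rule ccontr)
    assume "\<not> \<phi> p \<le> ereal M"
    then have "ereal M < \<phi> p" by simp
    then obtain d where d: "ereal M < ereal d" "ereal d < \<phi> p"
      using ereal_dense2 by blast
    have "eventually (\<lambda>n. ereal d < \<phi> (X n)) sequentially"
      using lower_semicontinuous_nhds[OF lsc d(2)] p by (rule eventually_compose_filterlim)
    moreover have "eventually (\<lambda>n. 1 / Suc n < d - M) sequentially"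
      using d(1) LIMSEQ_inverse_real_of_nat
      by (intro order_tendstoD(2)[of _ 0]) (simp_all add: inverse_eq_divide)
    ultimately have "eventually (\<lambda>n. False) sequentially"
    proof eventually_elim
      case (elim n)
      have "ereal d < ereal (M + 1 / Suc n)" using elim(1) X[of n] by (rule less_trans)
      then show False using elim(2) by simp
    qed
    then show False by simp
  qed
  then show thesis using low that order_trans by blast
qed

section \<open>Gradients\<close>

text \<open>The Riesz representation: \<open>g\<close> is the minimizer of \<open>1/2 \<parallel>u\<parallel>\<^sup>2 - D u\<close>, and quadratic growth
  at \<open>g\<close> in the directions \<open>v\<close> and \<open>-v\<close> identifies \<open>D\<close> with the inner product with \<open>g\<close>.\<close>

lemma riesz_representation:
  fixes D :: "'a::{real_inner, complete_space} \<Rightarrow> real"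
  assumes D: "bounded_linear D"
  obtains g where "\<And>v. D v = inner v g"
proof -
  interpret D: bounded_linear D by (rule D)
  define q where "q u = - D u + 1 / 2 * (norm u)\<^sup>2" for u
  have "linear (\<lambda>u. - D u)"
    using D.linear by (rule linear_compose_neg)
  from strongly_convex_quadratic[OF this, of 1 0]
  have sc: "strongly_convex 1 (\<lambda>u. ereal (q u))"
    by (simp add: q_def)
  have "lower_semicontinuous (\<lambda>u. 0 + ereal (q u))"
    by (rule lower_semicontinuous_add_continuous)
      (auto simp: q_def lower_semicontinuous_def le_Liminf_iff
        intro!: continuous_intros D.isCont)
  moreover have "proper (\<lambda>u. ereal (q u))" by (simp add: proper_def)
  ultimately obtain g where "\<And>u. ereal (q g) \<le> ereal (q u)"
    using strongly_convex_minimizer_exists[OF _ _ sc] by auto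
  from strongly_convex_minimizer_growth[OF sc _ this]
  have growth: "q g + 1 / 2 * (norm (u - g))\<^sup>2 \<le> q u" for u by simp
  have *: "D v \<le> inner v g" for v
    using growth[of "g + v"]
    by (simp add: q_def D.add power2_norm_eq_inner inner_simps inner_commute field_simps)
  show thesis
  proof
    fix v show "D v = inner v g"
      using *[of v] *[of "-v"] by (simp add: linear_neg[OF D.linear])
  qed
qed

lemma GDERIV_gradient:
  fixes f :: "'a::{real_inner, complete_space} \<Rightarrow> real"
  assumes "f differentiable (at x)"
  shows "GDERIV f x :> gradient f x"
proof -
  obtain D where D: "(f has_derivative D) (at x)"
    using assms by (auto simp: differentiable_def)
  then obtain g where "\<And>v. D v = inner v g"
    using riesz_representation has_derivative_bounded_linear by blast
  then have "D = (\<lambda>v. inner v g)" by blast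
  with D have "GDERIV f x :> g" by (simp add: gderiv_def)
  with gradient_eqI[OF this] show ?thesis by simp
qed

lemma DERIV_along_line:
  assumes "GDERIV f (y + t *\<^sub>R v) :> g"
  shows "((\<lambda>t. f (y + t *\<^sub>R v)) has_real_derivative inner v g) (at t)"
proof -
  have "((\<lambda>t. y + t *\<^sub>R v) has_derivative (\<lambda>s. s *\<^sub>R v)) (at t)"
    by (auto intro!: derivative_eq_intros)
  moreover have "(f has_derivative (\<lambda>w. inner w g)) (at (y + t *\<^sub>R v))"
    using assms by (simp add: gderiv_def)
  ultimately have "((\<lambda>t. f (y + t *\<^sub>R v)) has_derivative (\<lambda>s. inner (s *\<^sub>R v) g)) (at t)"
    by (rule has_derivative_compose)
  then show ?thesis
    by (simp add: has_field_derivative_def mult.commute[of _ "inner v g"])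
qed

lemma GDERIV_half_norm_squared:
  "GDERIV (\<lambda>x. c / 2 * (norm x)\<^sup>2) x :> c *\<^sub>R x"
  unfolding gderiv_def power2_norm_eq_inner
  by (auto intro!: derivative_eq_intros simp: inner_commute algebra_simps)

text \<open>Along the segment from \<open>y\<close> to \<open>u\<close>, the difference of the two sides has a derivative of constant
  sign, by the Cauchy-Schwarz inequality and the Lipschitz bound.\<close>

lemma descent_lemma:
  fixes f :: "'a::real_inner \<Rightarrow> real"
  assumes f: "\<And>x. GDERIV f x :> G x" and G: "L-lipschitz_on UNIV G"
  shows "f u \<le> f y + inner (u - y) (G y) + L / 2 * (norm (u - y))\<^sup>2"
proof -
  define v where "v = u - y"
  define w where "w t = f (y + t *\<^sub>R v) - t * inner v (G y) - L / 2 * t\<^sup>2 * (norm v)\<^sup>2" for t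
  have "w 0 \<ge> w 1"
  proof (rule DERIV_nonpos_imp_nonincreasing[of 0 1 w])
    fix t :: real assume t: "0 \<le> t"
    have d: "(w has_real_derivative
        (inner v (G (y + t *\<^sub>R v)) - inner v (G y) - L * t * (norm v)\<^sup>2)) (at t)"
      unfolding w_def by (rule derivative_eq_intros DERIV_along_line[OF f] | simp)+
    have "inner v (G (y + t *\<^sub>R v)) - inner v (G y) = inner v (G (y + t *\<^sub>R v) - G y)"
      by (simp add: inner_diff_right)
    also have "\<dots> \<le> norm v * norm (G (y + t *\<^sub>R v) - G y)" by (rule norm_cauchy_schwarz)
    also have "\<dots> \<le> norm v * (L * norm (t *\<^sub>R v))"
      using lipschitz_onD[OF G, of "y + t *\<^sub>R v" y]
      by (intro mult_left_mono) (simp_all add: dist_norm)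
    also have "\<dots> = L * t * (norm v)\<^sup>2" using t by (simp add: power2_eq_square)
    finally show "\<exists>d. (w has_real_derivative d) (at t) \<and> d \<le> 0"
      using d by (intro exI[of _ "inner v (G (y + t *\<^sub>R v)) - inner v (G y) - L * t * (norm v)\<^sup>2"])
        simp
  qed simp
  then show ?thesis by (simp add: w_def v_def)
qed

lemma convex_above_tangent:
  fixes g :: "'a::real_inner \<Rightarrow> real"
  assumes g: "convex_on UNIV g" and d: "GDERIV g y :> d"
  shows "g y + inner (u - y) d \<le> g u"
proof -
  define w where "w t = g (y + t *\<^sub>R (u - y))" for t
  have "convex_on UNIV w"
  proof (rule convex_onI)
    fix s a b :: real assume "0 < s" "s < 1"
    then have "g ((1 - s) *\<^sub>R (y + a *\<^sub>R (u - y)) + s *\<^sub>R (y + b *\<^sub>R (u - y)))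
        \<le> (1 - s) * w a + s * w b"
      unfolding w_def by (intro convex_onD[OF g]) auto
    moreover have "(1 - s) *\<^sub>R (y + a *\<^sub>R (u - y)) + s *\<^sub>R (y + b *\<^sub>R (u - y))
        = y + ((1 - s) *\<^sub>R a + s *\<^sub>R b) *\<^sub>R (u - y)"
      by (simp add: algebra_simps)
    ultimately show "w ((1 - s) *\<^sub>R a + s *\<^sub>R b) \<le> (1 - s) * w a + s * w b"
      by (simp add: w_def)
  qed simp
  moreover have "(w has_real_derivative inner (u - y) d) (at 0)"
    unfolding w_def by (rule DERIV_along_line) (simp add: d)
  ultimately have "inner (u - y) d * (1 - 0) \<le> w 1 - w 0"
    by (intro convex_on_imp_above_tangent[of UNIV]) auto
  then show ?thesis by (simp add: w_def)
qed

lemma strongly_convex_above_tangent: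
  fixes f :: "'a::real_inner \<Rightarrow> real"
  assumes sc: "strongly_convex \<mu> (\<lambda>u. ereal (f u))" and f: "GDERIV f y :> g"
  shows "f y + inner (u - y) g + \<mu> / 2 * (norm (u - y))\<^sup>2 \<le> f u"
proof -
  have "GDERIV (\<lambda>u. f u - \<mu> / 2 * (norm u)\<^sup>2) y :> g - \<mu> *\<^sub>R y"
    by (intro GDERIV_diff f GDERIV_half_norm_squared)
  from convex_above_tangent[OF _ this, of u] sc
  show ?thesis
    unfolding strongly_convex_ereal_iff
    by (simp add: power2_norm_eq_inner inner_simps inner_commute algebra_simps)
qed

section \<open>The forward-backward step\<close>

text \<open>The forward-backward point is defined as the minimizer of this function, which omits the
  constant \<open>f y\<close> of the quadratic upper model of \<open>f + h\<close> at \<open>y\<close>; here \<open>g\<close> is the gradient of \<open>f\<close>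
  at \<open>y\<close>.\<close>

definition fb_model ::
  "('a::real_inner \<Rightarrow> ereal) \<Rightarrow> real \<Rightarrow> 'a \<Rightarrow> 'a \<Rightarrow> 'a \<Rightarrow> ereal" where
  "fb_model h L g y u = h u + ereal (inner (u - y) g + L / 2 * (norm (u - y))\<^sup>2)"

lemma arg_min_pos_affine:
  fixes A B :: "'a \<Rightarrow> ereal"
  assumes "c > 0" and AB: "\<And>u. A u = ereal c * B u + ereal b"
  shows "arg_min A P = arg_min B P"
proof -
  have "A u < A v \<longleftrightarrow> B u < B v" for u v
    unfolding AB using \<open>c > 0\<close> by (cases "B u"; cases "B v") auto
  then show ?thesis by (simp add: arg_min_def is_arg_min_def)
qed

text \<open>The shift cancels here: the objective of the shifted proximal step is, up to a constant and the
  positive factor \<open>1/(L + \<delta>)\<close>, a function in which \<open>\<delta>\<close> does not occur.\<close>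

lemma prox_shifted_eq_arg_min_fb_model:
  fixes h :: "'a::real_inner \<Rightarrow> ereal"
  assumes L: "L + \<delta> > 0" and h: "\<And>u. h u \<noteq> -\<infinity>"
  shows "prox (\<lambda>u. ereal (1 / (L + \<delta>)) * shift_nonsmooth \<delta> h u)
      (y - (1 / (L + \<delta>)) *\<^sub>R (g + \<delta> *\<^sub>R y)) = arg_min (fb_model h L g y) (\<lambda>_. True)"
  unfolding prox_def
proof (rule arg_min_pos_affine)
  define c where "c = 1 / (L + \<delta>)"
  define w where "w = g + \<delta> *\<^sub>R y"
  define b where "b = c * (c / 2 * (norm w)\<^sup>2 - \<delta> / 2 * (norm y)\<^sup>2)"
  have c: "c > 0" "c * (L + \<delta>) = 1" using L by (auto simp: c_def)
  show "1 / (L + \<delta>) > 0" using L by simp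
  fix u
  have "1 / 2 * (norm (u - (y - c *\<^sub>R w)))\<^sup>2
      = 1 / 2 * (norm (u - y))\<^sup>2 + c * inner (u - y) w + c * (c / 2 * (norm w)\<^sup>2)"
    by (simp add: power2_norm_eq_inner inner_simps inner_commute algebra_simps)
  also have "1 / 2 * (norm (u - y))\<^sup>2 = c * ((L + \<delta>) / 2 * (norm (u - y))\<^sup>2)"
    using c(2) by (metis (no_types, opaque_lifting) mult.assoc mult.left_neutral times_divide_eq_right)
  finally have q: "1 / 2 * (norm (u - (y - c *\<^sub>R w)))\<^sup>2 = c * (\<delta> / 2 * (norm u)\<^sup>2)
      + c * (inner (u - y) g + L / 2 * (norm (u - y))\<^sup>2) + b"
    by (simp add: w_def b_def power2_norm_eq_inner inner_simps inner_commute algebra_simps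
        add_divide_distrib)
  show "ereal (1 / (L + \<delta>)) * shift_nonsmooth \<delta> h u
      + ereal (1 / 2 * (norm (u - (y - (1 / (L + \<delta>)) *\<^sub>R (g + \<delta> *\<^sub>R y))))\<^sup>2)
    = ereal (1 / (L + \<delta>)) * fb_model h L g y u + ereal b"
    unfolding c_def[symmetric] w_def[symmetric] q
    using h[of u] c(1)
    by (cases "h u") (auto simp: shift_nonsmooth_def fb_model_def algebra_simps)
qed

lemma arg_min_le_if_minimizer_exists:
  fixes \<phi> :: "'a \<Rightarrow> ereal"
  assumes "\<And>u. \<phi> p \<le> \<phi> u"
  shows "\<phi> (arg_min \<phi> (\<lambda>_. True)) \<le> \<phi> u"
proof -
  have "is_arg_min \<phi> (\<lambda>_. True) p" using assms by (simp add: is_arg_min_linorder)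
  then have "is_arg_min \<phi> (\<lambda>_. True) (arg_min \<phi> (\<lambda>_. True))"
    unfolding arg_min_def by (rule someI)
  then show ?thesis by (simp add: is_arg_min_linorder)
qed

lemma fb_model_growth:
  fixes h :: "'a::{real_inner, complete_space} \<Rightarrow> ereal" and g y :: 'a
  assumes h: "proper h" "lower_semicontinuous h" "strongly_convex \<rho> h" and "\<rho> + L > 0"
  defines "T \<equiv> arg_min (fb_model h L g y) (\<lambda>_. True)"
  shows "fb_model h L g y T + ereal ((\<rho> + L) / 2 * (norm (u - T))\<^sup>2) \<le> fb_model h L g y u"
proof -
  let ?q = "\<lambda>u. inner (u - y) g + L / 2 * (norm (u - y))\<^sup>2"
  have eq: "fb_model h L g y = (\<lambda>u. h u + ereal (?q u))"
    by (simp add: fb_model_def fun_eq_iff)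
  have hfin: "h u \<noteq> -\<infinity>" for u using h(1) by (simp add: proper_def)
  obtain c where c: "h c \<noteq> \<infinity>" using h(1) by (auto simp: proper_def)
  have fin: "fb_model h L g y u \<noteq> -\<infinity>" for u
    using hfin[of u] by (cases "h u") (auto simp: fb_model_def)
  have sc: "strongly_convex (\<rho> + L) (fb_model h L g y)"
    unfolding eq
    by (intro strongly_convex_add_real hfin h strongly_convex_quadratic bounded_linear.linear
        bounded_linear_inner_left)
  have lsc: "lower_semicontinuous (fb_model h L g y)"
    unfolding eq
    by (intro lower_semicontinuous_add_continuous hfin h continuous_intros)
  have "fb_model h L g y c \<noteq> \<infinity>"
    using c by (cases "h c") (auto simp: fb_model_def)
  then have "proper (fb_model h L g y)"
    using fin by (auto simp: proper_def)
  then obtain p where "\<And>u. fb_model h L g y p \<le> fb_model h L g y u"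
    using lsc sc \<open>\<rho> + L > 0\<close> by (rule strongly_convex_minimizer_exists) blast
  then have "fb_model h L g y T \<le> fb_model h L g y u" for u
    unfolding T_def by (rule arg_min_le_if_minimizer_exists)
  with sc fin show ?thesis by (rule strongly_convex_minimizer_growth)
qed

text \<open>The descent lemma bounds \<open>f + h\<close> at the new point by the model, the growth of the model bounds
  the latter by its value at an arbitrary \<open>u\<close>, and strong convexity of \<open>f\<close> bounds that value by
  \<open>f + h\<close> at \<open>u\<close>.\<close>

lemma forward_backward_inequality:
  fixes f :: "'a::{real_inner, complete_space} \<Rightarrow> real" and h :: "'a \<Rightarrow> ereal"
    and y :: 'a
  assumes f: "\<And>x. GDERIV f x :> G x" "strongly_convex \<mu> (\<lambda>u. ereal (f u))"
    and G: "L-lipschitz_on UNIV G"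
    and h: "proper h" "lower_semicontinuous h" "strongly_convex \<rho> h" and pos: "\<rho> + L > 0"
  defines "T \<equiv> arg_min (fb_model h L (G y) y) (\<lambda>_. True)"
  shows "(ereal (f T) + h T) + ereal ((L + \<rho>) / 2 * (norm (u - T))\<^sup>2)
    \<le> (ereal (f u) + h u) + ereal ((L - \<mu>) / 2 * (norm (u - y))\<^sup>2)"
proof (cases "h u")
  case (real b)
  have "fb_model h L (G y) y T + ereal ((\<rho> + L) / 2 * (norm (u - T))\<^sup>2) \<le> fb_model h L (G y) y u"
    unfolding T_def by (rule fb_model_growth[OF h pos])
  moreover from this obtain a where a: "h T = ereal a"
    using h(1) real by (cases "h T") (auto simp: proper_def fb_model_def)
  moreover have "f T \<le> f y + inner (T - y) (G y) + L / 2 * (norm (T - y))\<^sup>2"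
    by (rule descent_lemma[OF f(1) G])
  moreover have "f y + inner (u - y) (G y) + \<mu> / 2 * (norm (u - y))\<^sup>2 \<le> f u"
    by (rule strongly_convex_above_tangent[OF f(2,1)])
  ultimately show ?thesis
    using real by (simp add: fb_model_def algebra_simps diff_divide_distrib add_divide_distrib)
qed (use h(1) in \<open>auto simp: proper_def\<close>)

section \<open>The Lyapunov function\<close>

text \<open>The comparison point \<open>u\<close> is chosen so that \<open>u - x'\<close> is a multiple of \<open>s - z'\<close>; the relation
  between \<open>\<alpha>\<close>, \<open>m\<close> and \<open>\<Lambda>\<close> turns the weight of that square into \<open>m/2\<close>. The point \<open>u - y\<close> is a
  combination of \<open>s - z\<close> and \<open>s - x\<close>, and the strong convexity term at \<open>x\<close> absorbs the latter.\<close>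

lemma lyapunov_decrease:
  fixes x x' y s :: "'a::real_inner"
  assumes \<alpha>: "0 < \<alpha>" "\<alpha> < 1" and \<Lambda>: "\<Lambda> * \<alpha>\<^sup>2 = m" and m: "m > 0"
  defines "z \<equiv> x + (1 + 1 / \<alpha>) *\<^sub>R (y - x)" and "z' \<equiv> x + (1 / \<alpha>) *\<^sub>R (x' - x)"
    and "u \<equiv> (1 - \<alpha>) *\<^sub>R x + \<alpha> *\<^sub>R s"
  assumes step: "Fx' + \<Lambda> / 2 * (norm (u - x'))\<^sup>2 \<le> Fu + (\<Lambda> - m) / 2 * (norm (u - y))\<^sup>2"
    and conv: "Fu \<le> (1 - \<alpha>) * Fx + \<alpha> * Fs - m / 2 * (\<alpha> * (1 - \<alpha>)) * (norm (x - s))\<^sup>2"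
  shows "Fx' - Fs + m / 2 * (norm (z' - s))\<^sup>2 \<le> (1 - \<alpha>) * (Fx - Fs + m / 2 * (norm (z - s))\<^sup>2)"
proof -
  define A B where "A = (norm (z - s))\<^sup>2" and "B = (norm (x - s))\<^sup>2"
  have "u - x' = (- \<alpha>) *\<^sub>R (z' - s)"
    using \<alpha> by (simp add: u_def z'_def algebra_simps)
  then have 1: "\<Lambda> * (norm (u - x'))\<^sup>2 = m * (norm (z' - s))\<^sup>2"
    using \<Lambda> by (simp add: power_mult_distrib)
  have "\<alpha> *\<^sub>R z = \<alpha> *\<^sub>R x + (1 + \<alpha>) *\<^sub>R (y - x)"
    using \<alpha> by (simp add: z_def scaleR_right_distrib distrib_left add.commute)
  then have "(1 + \<alpha>) *\<^sub>R (u - y) = (- \<alpha>) *\<^sub>R ((z - s) + \<alpha> *\<^sub>R (x - s))"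
    by (simp add: u_def algebra_simps)
  then have "(norm ((1 + \<alpha>) *\<^sub>R (u - y)))\<^sup>2 = (norm ((- \<alpha>) *\<^sub>R ((z - s) + \<alpha> *\<^sub>R (x - s))))\<^sup>2"
    by (rule arg_cong)
  then have "(1 + \<alpha>)\<^sup>2 * (norm (u - y))\<^sup>2 = \<alpha>\<^sup>2 * (norm ((z - s) + \<alpha> *\<^sub>R (x - s)))\<^sup>2"
    by (simp only: norm_scaleR power_mult_distrib power2_abs power2_minus)
  moreover have "(norm ((z - s) + \<alpha> *\<^sub>R (x - s)))\<^sup>2 \<le> (1 + \<alpha>) * (A + \<alpha> * B)"
  proof -
    have "(1 + \<alpha>) * ((norm v)\<^sup>2 + \<alpha> * (norm w)\<^sup>2) - (norm (v + \<alpha> *\<^sub>R w))\<^sup>2 = \<alpha> * (norm (v - w))\<^sup>2"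
      for v w :: 'a
      unfolding power2_norm_eq_inner by (simp add: inner_simps inner_commute algebra_simps)
    from this[of "z - s" "x - s"] have
      "(1 + \<alpha>) * (A + \<alpha> * B) - (norm ((z - s) + \<alpha> *\<^sub>R (x - s)))\<^sup>2 \<ge> 0"
      using \<alpha> by (simp add: A_def B_def)
    then show ?thesis by simp
  qed
  ultimately have "(1 + \<alpha>)\<^sup>2 * (norm (u - y))\<^sup>2 \<le> \<alpha>\<^sup>2 * ((1 + \<alpha>) * (A + \<alpha> * B))"
    by (simp add: mult_left_mono)
  then have "(1 + \<alpha>) * ((1 + \<alpha>) * (norm (u - y))\<^sup>2) \<le> (1 + \<alpha>) * (\<alpha>\<^sup>2 * (A + \<alpha> * B))"
    by (simp add: power2_eq_square algebra_simps)
  then have "(1 + \<alpha>) * (norm (u - y))\<^sup>2 \<le> \<alpha>\<^sup>2 * (A + \<alpha> * B)"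
    using \<alpha> by simp
  moreover have pos: "\<Lambda> * (1 - \<alpha>) \<ge> 0"
  proof -
    have "\<Lambda> = m / \<alpha>\<^sup>2" using \<Lambda> \<alpha> by (simp add: field_simps)
    then show ?thesis using m \<alpha> by simp
  qed
  ultimately have "\<Lambda> * (1 - \<alpha>) * ((1 + \<alpha>) * (norm (u - y))\<^sup>2) \<le> \<Lambda> * (1 - \<alpha>) * (\<alpha>\<^sup>2 * (A + \<alpha> * B))"
    by (rule mult_left_mono)
  then have 2: "(\<Lambda> - m) * (norm (u - y))\<^sup>2 \<le> m * (1 - \<alpha>) * (A + \<alpha> * B)"
    unfolding \<Lambda>[symmetric] by (simp add: algebra_simps power2_eq_square)
  have "Fx' + m / 2 * (norm (z' - s))\<^sup>2
      \<le> (1 - \<alpha>) * Fx + \<alpha> * Fs - m / 2 * (\<alpha> * (1 - \<alpha>)) * B + m * (1 - \<alpha>) * (A + \<alpha> * B) / 2"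
    using step conv 1 2 by (simp add: B_def)
  also have "\<dots> = Fs + (1 - \<alpha>) * (Fx - Fs + m / 2 * A)"
    by (simp add: field_simps)
  finally show ?thesis by (simp add: A_def)
qed

text \<open>At a point \<open>x\<close> outside of the domain of \<open>h\<close> the right-hand side is \<open>\<infinity>\<close>, since \<open>\<alpha> < 1\<close>. This
  case matters because the starting point is arbitrary.\<close>

lemma Phi_forward_backward_decrease:
  fixes f :: "'a::{real_inner, complete_space} \<Rightarrow> real" and h :: "'a \<Rightarrow> ereal"
    and y :: 'a
  assumes f: "\<And>x. GDERIV f x :> G x" "strongly_convex \<mu> (\<lambda>u. ereal (f u))"
    and G: "L-lipschitz_on UNIV G"
    and h: "proper h" "lower_semicontinuous h" "strongly_convex \<rho> h"
    and \<mu>: "\<mu> < L" "\<mu> + \<rho> > 0"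
  defines "F \<equiv> \<lambda>u. ereal (f u) + h u"
  assumes s: "\<And>u. F s \<le> F u"
  defines "\<alpha> \<equiv> sqrt ((\<mu> + \<rho>) / (L + \<rho>))"
    and "x' \<equiv> arg_min (fb_model h L (G y) y) (\<lambda>_. True)"
  shows "Phi F s \<mu> \<rho> x' (x + (1 / \<alpha>) *\<^sub>R (x' - x))
    \<le> ereal (1 - \<alpha>) * Phi F s \<mu> \<rho> x (x + (1 + 1 / \<alpha>) *\<^sub>R (y - x))"
proof -
  have \<alpha>: "0 < \<alpha>" "\<alpha> < 1" "(L + \<rho>) * \<alpha>\<^sup>2 = \<mu> + \<rho>"
    using \<mu> by (auto simp: \<alpha>_def)
  have fin: "F u \<noteq> -\<infinity>" for u
    using h(1) by (cases "h u") (auto simp: F_def proper_def)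
  obtain c where "h c \<noteq> \<infinity>" using h(1) by (auto simp: proper_def)
  then have "F c \<noteq> \<infinity>" by (simp add: F_def)
  with s[of c] fin[of s] obtain Fs where Fs: "F s = ereal Fs" by (cases "F s") auto
  show ?thesis
  proof (cases "F x")
    case (real Fx)
    define u where "u = (1 - \<alpha>) *\<^sub>R x + \<alpha> *\<^sub>R s"
    have "strongly_convex (\<mu> + \<rho>) F"
      using strongly_convex_add_real[OF _ h(3) f(2)] h(1)
      by (simp add: F_def proper_def add.commute)
    from strongly_convexD[OF this fin \<alpha>(1,2) real Fs]
    have conv: "F u \<le> ereal ((1 - \<alpha>) * Fx + \<alpha> * Fs
        - (\<mu> + \<rho>) / 2 * (\<alpha> * (1 - \<alpha>)) * (norm (x - s))\<^sup>2)"
      by (simp add: u_def)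
    then obtain Fu where Fu: "F u = ereal Fu" using fin[of u] by (cases "F u") auto
    have "\<rho> + L > 0" using \<mu> by simp
    from forward_backward_inequality[OF f G h this, of y u]
    have step: "F x' + ereal ((L + \<rho>) / 2 * (norm (u - x'))\<^sup>2)
        \<le> F u + ereal ((L - \<mu>) / 2 * (norm (u - y))\<^sup>2)"
      by (simp add: F_def x'_def)
    then obtain Fx' where Fx': "F x' = ereal Fx'"
      using fin[of x'] Fu by (cases "F x'") auto
    show ?thesis
      using lyapunov_decrease[OF \<alpha> \<mu>(2), where x = x and y = y and x' = x' and s = s and Fx' = Fx'
          and Fu = Fu and Fx = Fx and Fs = Fs] step[unfolded Fx' Fu] conv[unfolded Fu]
      by (simp add: Phi_def Fs Fx' real u_def)
  next
    case PInf
    then have "Phi F s \<mu> \<rho> x (x + (1 + 1 / \<alpha>) *\<^sub>R (y - x)) = \<infinity>"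
      by (simp add: Phi_def Fs)
    then show ?thesis using \<alpha> by simp
  qed (use fin in auto)
qed

theorem corollary4p2:
  fixes f :: "'a::{real_inner, complete_space} \<Rightarrow> real"
    and h F :: "'a \<Rightarrow> ereal"
    and L \<mu> \<rho> \<delta> :: real
    and xstar x0 y0 :: 'a
  assumes "L > 0" and "\<mu> \<in> {0..<L}" and "\<rho> \<ge> 0" and "\<mu> + \<rho> > 0"
    and "\<forall>u. f differentiable (at u)"
    and "strongly_convex \<mu> (\<lambda>u. ereal (f u))"
    and "L-lipschitz_on UNIV (gradient f)"
    and "proper h" and "lower_semicontinuous h" and "strongly_convex \<rho> h"
    and F_eq: "F = (\<lambda>u. ereal (f u) + h u)"
    and xstar_eq: "xstar = (THE u. is_arg_min F (\<lambda>_. True) u)"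
    and "\<delta> \<in> {-\<mu>..\<rho>}"
  shows "(\<forall>x y. shifted_algorithm f h L \<mu> \<rho> \<delta> x0 y0 x y \<longleftrightarrow> unshifted_algorithm f h L \<mu> \<rho> x0 y0 x y) \<and>
    (\<forall>x y. shifted_algorithm f h L \<mu> \<rho> \<delta> x0 y0 x y \<longrightarrow>
       (\<forall>k. Phi F xstar \<mu> \<rho> (x k) (z_seq L \<mu> \<rho> x y k)
            \<le> ereal ((1 - sqrt ((\<mu> + \<rho>) / (L + \<rho>))) ^ k) * Phi F xstar \<mu> \<rho> (x 0) (z_seq L \<mu> \<rho> x y 0)))"
proof -
  have hfin: "h u \<noteq> -\<infinity>" for u using \<open>proper h\<close> by (simp add: proper_def)
  have Gf: "GDERIV f u :> gradient f u" for u
    using \<open>\<forall>u. f differentiable (at u)\<close> GDERIV_gradient by blast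
  define m where "m = \<mu> + \<rho>"
  define \<Lambda> where "\<Lambda> = L + \<rho>"
  define \<alpha> where "\<alpha> = sqrt (m / \<Lambda>)"
  have m: "m > 0" "m < \<Lambda>" "\<Lambda> > 0" and \<mu>L: "\<mu> < L" and L\<delta>: "L + \<delta> > 0"
    using assms(1-4,13) by (auto simp: m_def \<Lambda>_def)

  have prox_unshifted: "prox (\<lambda>u. ereal (1 / L) * h u) (v - (1 / L) *\<^sub>R gradient f v)
      = arg_min (fb_model h L (gradient f v) v) (\<lambda>_. True)" for v
    using prox_shifted_eq_arg_min_fb_model[where h = h and L = L and \<delta> = 0 and y = v] hfin
      \<open>L > 0\<close> by (simp add: shift_nonsmooth_def zero_ereal_def[symmetric])

  have shifted: "shifted_algorithm f h L \<mu> \<rho> \<delta> x0 y0 x y \<longleftrightarrow>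
      unshifted_algorithm f h L \<mu> \<rho> x0 y0 x y" for x y
  proof -
    have grad: "gradient (shift_smooth \<delta> f) v = gradient f v + \<delta> *\<^sub>R v" for v
      unfolding shift_smooth_def[abs_def]
      by (intro gradient_eqI GDERIV_add Gf GDERIV_half_norm_squared)
    have "prox (\<lambda>u. ereal (1 / (L + \<delta>)) * shift_nonsmooth \<delta> h u)
        (v - (1 / (L + \<delta>)) *\<^sub>R gradient (shift_smooth \<delta> f) v)
        = arg_min (fb_model h L (gradient f v) v) (\<lambda>_. True)" for v
      unfolding grad by (rule prox_shifted_eq_arg_min_fb_model[where h = h, OF L\<delta> hfin])
    moreover note prox_unshifted
    moreover have "(\<rho> - \<delta>) + (L + \<delta>) = L + \<rho>" "(\<rho> - \<delta>) + (\<mu> + \<delta>) = \<mu> + \<rho>" by simp_all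
    ultimately show ?thesis
      unfolding shifted_algorithm_def unshifted_algorithm_def by presburger
  qed

  have xstar: "F xstar \<le> F u" for u
  proof -
    have F_eq': "F = (\<lambda>u. h u + ereal (f u))"
      by (simp add: F_eq add.commute)
    have fin: "F u \<noteq> -\<infinity>" for u
      using hfin[of u] by (cases "h u") (auto simp: F_eq)
    obtain c where "h c \<noteq> \<infinity>" using \<open>proper h\<close> by (auto simp: proper_def)
    then have "F c \<noteq> \<infinity>" by (simp add: F_eq)
    with fin have "proper F" by (auto simp: proper_def)
    moreover have "isCont f u" for u
      using assms(5) by (simp add: differentiable_imp_continuous_within)
    then have "lower_semicontinuous F"
      unfolding F_eq' by (intro lower_semicontinuous_add_continuous assms hfin)
    moreover have sc: "strongly_convex (\<rho> + \<mu>) F"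
      unfolding F_eq' by (intro strongly_convex_add_real hfin assms)
    moreover have "\<rho> + \<mu> > 0" using \<open>\<mu> + \<rho> > 0\<close> by simp
    ultimately obtain p where p: "\<And>u. F p \<le> F u"
      by (rule strongly_convex_minimizer_exists) blast
    have "q = p" if q: "\<And>u. F q \<le> F u" for q
    proof -
      have "F p + ereal ((\<rho> + \<mu>) / 2 * (norm (q - p))\<^sup>2) \<le> F p"
        using strongly_convex_minimizer_growth[OF sc fin p, of q] q[of p] by (rule order_trans)
      moreover obtain a where "F p = ereal a"
        using fin[of p] p[of c] \<open>F c \<noteq> \<infinity>\<close> by (cases "F p") auto
      ultimately have "(\<rho> + \<mu>) / 2 * (norm (q - p))\<^sup>2 \<le> 0" by simp
      then show ?thesis using \<open>\<mu> + \<rho> > 0\<close> by (simp add: mult_le_0_iff)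
    qed
    then have "xstar = p"
      unfolding xstar_eq using p by (intro the_equality) (auto simp: is_arg_min_linorder)
    with p show ?thesis by simp
  qed

  have rate: "Phi F xstar \<mu> \<rho> (x k) (z_seq L \<mu> \<rho> x y k)
      \<le> ereal ((1 - \<alpha>) ^ k) * Phi F xstar \<mu> \<rho> (x 0) (z_seq L \<mu> \<rho> x y 0)"
    if alg: "unshifted_algorithm f h L \<mu> \<rho> x0 y0 x y" for x y k
  proof (induction k)
    case (Suc k)
    have x': "x (Suc k) = arg_min (fb_model h L (gradient f (y k)) (y k)) (\<lambda>_. True)"
      and y': "y (Suc k) = x (Suc k) + ((sqrt \<Lambda> - sqrt m) / (sqrt \<Lambda> + sqrt m)) *\<^sub>R (x (Suc k) - x k)"
      using alg unfolding unshifted_algorithm_def by (simp_all add: prox_unshifted m_def \<Lambda>_def)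
    have sq: "sqrt m > 0" "sqrt \<Lambda> > 0" using m by simp_all
    have \<alpha>_eq: "(sqrt \<Lambda> + sqrt m) / sqrt m = 1 + 1 / \<alpha>"
      using sq by (simp add: \<alpha>_def real_sqrt_divide field_simps)
    have z: "z_seq L \<mu> \<rho> x y j = x j + (1 + 1 / \<alpha>) *\<^sub>R (y j - x j)" for j
      by (simp add: z_seq_def m_def[symmetric] \<Lambda>_def[symmetric] \<alpha>_eq)
    \<comment> \<open>The momentum coefficient is the one for which the next auxiliary point is an extrapolation
      from the current iterate along the last step.\<close>
    have "(1 + 1 / \<alpha>) * ((sqrt \<Lambda> - sqrt m) / (sqrt \<Lambda> + sqrt m)) = 1 / \<alpha> - 1"
    proof -
      have "sqrt \<Lambda> + sqrt m \<noteq> 0" using sq by linarith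
      then have "(1 + 1 / \<alpha>) * ((sqrt \<Lambda> - sqrt m) / (sqrt \<Lambda> + sqrt m)) = (sqrt \<Lambda> - sqrt m) / sqrt m"
        unfolding \<alpha>_eq[symmetric] by simp
      also have "\<dots> = 1 / \<alpha> - 1"
        using sq by (simp add: \<alpha>_def real_sqrt_divide diff_divide_distrib)
      finally show ?thesis .
    qed
    then have z': "z_seq L \<mu> \<rho> x y (Suc k) = x k + (1 / \<alpha>) *\<^sub>R (x (Suc k) - x k)"
      by (simp add: z y' scaleR_left_diff_distrib)
    have "Phi F xstar \<mu> \<rho> (x (Suc k)) (z_seq L \<mu> \<rho> x y (Suc k))
        \<le> ereal (1 - \<alpha>) * Phi F xstar \<mu> \<rho> (x k) (z_seq L \<mu> \<rho> x y k)"
      using xstar Phi_forward_backward_decrease[OF Gf assms(6,7,8,9,10) \<mu>L assms(4),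
          of xstar "y k" "x k"]
      unfolding z' z[of k] by (simp add: F_eq x'[symmetric] \<alpha>_def m_def \<Lambda>_def)
    also have "\<dots> \<le> ereal (1 - \<alpha>)
        * (ereal ((1 - \<alpha>) ^ k) * Phi F xstar \<mu> \<rho> (x 0) (z_seq L \<mu> \<rho> x y 0))"
      using m by (intro ereal_mult_left_mono Suc.IH) (simp add: \<alpha>_def)
    finally show ?case by (simp add: mult.assoc[symmetric])
  qed (simp flip: one_ereal_def)

  show ?thesis using shifted rate by (simp add: \<alpha>_def m_def \<Lambda>_def)
qed

end
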